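(* Let $A\ge 0$ be an integer. The assignment sending a lattice topological field theory $(C_{ijk},g^{ij})$ with color set $\{0,1,\dots,A\}$ to the complex vector space $R=\bigoplus_{i=0}^{A}\mathbb{C}\phi_i$ equipped with the bilinear product $\phi_i\phi_j=\sum_k C_{ij}{}^{k}\phi_k$, where $C_{ij}{}^{k}=\sum_l C_{ijl}\,g^{lk}$, is a one-to-one correspondence between the set of all lattice topological field theories with color set $\{0,\dots,A\}$ and the set of all semisimple associative $\mathbb{C}$-algebras $R$ of dimension $A+1$ (presented by structure constants with respect to a basis $\phi_0,\dots,\phi_A$). The inverse correspondence sends such an algebra with structure constants $C_{ij}{}^{k}$ to the data given by $g_{ij}=\sum_{k,l}C_{ik}{}^{l}C_{jl}{}^{k}$, $(g^{ij})=(g_{ij})^{-1}$ and $C_{ijk}=\sum_l C_{ij}{}^{l}g_{lk}$.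
   Context: A lattice topological field theory (LTFT) with color set $\{0,\dots,A\}$ consists of complex numbers $C_{ijk}$ and $g^{ij}$ ($0\le i,j,k\le A$) such that: (i) $C_{ijk}=C_{jki}=C_{kij}$ (cyclic symmetry; total symmetry is not required); (ii) $g^{ij}=g^{ji}$ and the matrix $(g^{ij})$ is invertible with inverse $(g_{ij})$; indices are raised and lowered with $g^{ij}$ and $g_{ij}$, in particular $C_{ij}{}^{k}=\sum_l C_{ijl}g^{lk}$; (iii) invariance under the fusion move: $\sum_p C_{ij}{}^{p}C_{pk}{}^{l}=\sum_p C_{jk}{}^{p}C_{ip}{}^{l}$ for all $i,j,k,l$; (iv) invariance under the bubble move: $g_{ij}=\sum_{k,l}C_{ik}{}^{l}C_{jl}{}^{k}$ for all $i,j$. (Here $C_{ijk}$ is the weight of an oriented triangle with edges colored in cyclic order by $i,j,k$, triangles are glued along edges using $g^{ij}$, and (iii), (iv) express the invariance of the resulting partition function under the two two-dimensional Matveev moves.) A finite-dimensional associative $\mathbb{C}$-algebra is semisimple if it is isomorphic to a finite direct product of matrix algebras over $\mathbb{C}$. *)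

theory Defs
  imports "HOL-Analysis.Analysis" "Jordan_Normal_Form.Matrix"
begin

(* Both libraries declare an infix "$"; here it is always the component selector of 'a ^ 'n. *)
no_notation vec_index (infixl "$" 100)

(* The color set {0,...,A} is modelled by a type 'n of class finite with A + 1 elements, the
   matrix (g^{ij}) by an element of complex ^ 'n ^ 'n, and its inverse (g_{ij}) by matrix_inv g. *)

type_synonym 'n tensor3 = "'n \<Rightarrow> 'n \<Rightarrow> 'n \<Rightarrow> complex"

type_synonym 'n product = "complex ^ 'n \<Rightarrow> complex ^ 'n \<Rightarrow> complex ^ 'n"

(* C_{ij}^k = sum_l C_{ijl} g^{lk} *)
definition raise_last :: "'n::finite tensor3 \<Rightarrow> complex ^ 'n ^ 'n \<Rightarrow> 'n tensor3" where
  "raise_last C g i j k = (\<Sum>l\<in>UNIV. C i j l * g $ l $ k)"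

definition is_ltft :: "'n::finite tensor3 \<Rightarrow> complex ^ 'n ^ 'n \<Rightarrow> bool" where
  "is_ltft C g \<longleftrightarrow>
     (\<forall>i j k. C i j k = C j k i \<and> C j k i = C k i j) \<and>
     (\<forall>i j. g $ i $ j = g $ j $ i) \<and>
     invertible g \<and>
     (\<forall>i j k l. (\<Sum>p\<in>UNIV. raise_last C g i j p * raise_last C g p k l) =
                (\<Sum>p\<in>UNIV. raise_last C g j k p * raise_last C g i p l)) \<and>
     (\<forall>i j. matrix_inv g $ i $ j =
                (\<Sum>k\<in>UNIV. \<Sum>l\<in>UNIV. raise_last C g i k l * raise_last C g j l k))"

definition ltfts :: "('n::finite tensor3 \<times> (complex ^ 'n ^ 'n)) set" where
  "ltfts = {(C, g). is_ltft C g}"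

definition basis_vec :: "'n::finite \<Rightarrow> complex ^ 'n" ("\<phi>") where
  "\<phi> i = axis i 1"

(* "linear" over the complex numbers: the constants linear and bilinear of HOL-Analysis
   only express real linearity. *)
definition complex_bilinear :: "'n::finite product \<Rightarrow> bool" where
  "complex_bilinear m \<longleftrightarrow>
     (\<forall>x. Vector_Spaces.linear (*s) (*s) (\<lambda>y. m x y)) \<and>
     (\<forall>y. Vector_Spaces.linear (*s) (*s) (\<lambda>x. m x y))"

(* An element of the direct product of r matrix algebras of sizes n 0, ..., n (r - 1) is a family
   of matrices indexed by {..<r}. No unit is demanded in advance: a bijection that respects
   products transports the unit of the matrix algebra. *)
definition matrix_algebra_iso ::
    "'n::finite product \<Rightarrow> nat \<Rightarrow> (nat \<Rightarrow> nat) \<Rightarrow> (complex ^ 'n \<Rightarrow> nat \<Rightarrow> complex mat) \<Rightarrow> bool" where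
  "matrix_algebra_iso m r n \<Phi> \<longleftrightarrow>
     bij_betw \<Phi> UNIV (\<Pi>\<^sub>E b\<in>{..<r}. carrier_mat (n b) (n b)) \<and>
     (\<forall>b<r. (\<forall>x y. \<Phi> (x + y) b = \<Phi> x b + \<Phi> y b) \<and>
            (\<forall>c x. \<Phi> (c *s x) b = c \<cdot>\<^sub>m \<Phi> x b) \<and>
            (\<forall>x y. \<Phi> (m x y) b = \<Phi> x b * \<Phi> y b))"

definition semisimple_algebra :: "'n::finite product \<Rightarrow> bool" where
  "semisimple_algebra m \<longleftrightarrow>
     complex_bilinear m \<and>
     (\<forall>x y z. m (m x y) z = m x (m y z)) \<and>
     (\<exists>r n \<Phi>. (\<forall>b<r. 0 < n b) \<and> matrix_algebra_iso m r n \<Phi>)"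

(* The algebras with underlying space R = complex ^ 'n, whose standard basis is the family \<phi>;
   the dimension is therefore CARD('n). *)
definition semisimple_algebras :: "'n::finite product set" where
  "semisimple_algebras = {m. semisimple_algebra m}"

definition ltft_algebra :: "'n::finite tensor3 \<times> (complex ^ 'n ^ 'n) \<Rightarrow> 'n product" where
  "ltft_algebra = (\<lambda>(C, g) x y.
     \<Sum>i\<in>UNIV. \<Sum>j\<in>UNIV. (x $ i * y $ j) *s (\<Sum>k\<in>UNIV. raise_last C g i j k *s \<phi> k))"

(* the coefficient of \<phi> k in the product of \<phi> i and \<phi> j *)
definition struct_const :: "'n::finite product \<Rightarrow> 'n tensor3" where
  "struct_const m i j k = m (\<phi> i) (\<phi> j) $ k"

(* g_{ij} = sum_{k,l} C_{ik}^l C_{jl}^k, with lower indices *)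
definition algebra_metric :: "'n::finite product \<Rightarrow> complex ^ 'n ^ 'n" where
  "algebra_metric m =
     (\<chi> i j. \<Sum>k\<in>UNIV. \<Sum>l\<in>UNIV. struct_const m i k l * struct_const m j l k)"

definition algebra_ltft :: "'n::finite product \<Rightarrow> 'n tensor3 \<times> (complex ^ 'n ^ 'n)" where
  "algebra_ltft m =
     ((\<lambda>i j k. \<Sum>l\<in>UNIV. struct_const m i j l * algebra_metric m $ l $ k),
      matrix_inv (algebra_metric m))"

lemma sum_scaled_basis_nth: "(\<Sum>k\<in>UNIV. c k *s \<phi> k) $ l = c l"
proof -
  have "(\<Sum>k\<in>UNIV. c k *s \<phi> k) $ l = (\<Sum>k\<in>UNIV. if k = l then c k else 0)"
    unfolding sum_component
    by (rule sum.cong) (auto simp: basis_vec_def axis_def)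
  then show ?thesis by simp
qed

lemma ltft_algebra_basis:
  "ltft_algebra (C, g) (\<phi> i) (\<phi> j) = (\<Sum>k\<in>UNIV. raise_last C g i j k *s \<phi> k)"
proof -
  let ?v = "\<lambda>a b. \<Sum>k\<in>UNIV. raise_last C g a b k *s \<phi> k"
  have "ltft_algebra (C, g) (\<phi> i) (\<phi> j) =
      (\<Sum>a\<in>UNIV. \<Sum>b\<in>UNIV. if b = j then (if a = i then ?v a b else 0) else 0)"
    unfolding ltft_algebra_def prod.case
    by (intro sum.cong refl) (auto simp: basis_vec_def axis_def)
  then show ?thesis by simp
qed

lemma struct_const_ltft_algebra: "struct_const (ltft_algebra (C, g)) = raise_last C g"
  by (intro ext) (simp only: struct_const_def ltft_algebra_basis sum_scaled_basis_nth)

end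

(* The trace form tr (L_x L_y) of the left regular representation has the matrix
   g_ij = sum_{k,l} C_ik^l C_jl^k, so the bubble move says that g^{ij} is its inverse, the fusion
   move is associativity, and cyclicity of C_ijk = tr (L_i L_j L_k) is cyclicity of the trace.
   What remains is that an associative complex algebra is semisimple iff its trace form is
   nondegenerate.
   If the form is nondegenerate, representing the functional x |-> tr L_x yields a unit, and a
   minimal nonzero left ideal K satisfies K K <> 0, since otherwise (x y)(x y) = 0, hence
   tr L_xy = 0, for all x in K and y in R.  By Brauer's argument K = R e with e idempotent
   and e R e = C e.  Take a maximal family of such idempotents with e R f = 0 for e <> f.  It is
   finite, and R acts faithfully on the direct sum of the left ideals R e.  With a basis y_i of R e
   and the dual family x_i in e R, x_i y_j = delta_ij e, the matrix of v on R e is given by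
   x_i v y_j = Phi(v)_ij e, and Phi is onto because sum_ij M_ij y_i x_j is mapped to M.
   Conversely, with the matrix units E_pq of a block, tr (E_pp x E_qp) = x_pq tr (E_pp), and the
   trace of the nonzero idempotent L(E_pp) is its rank, which is not 0. *)

theory Submission
  imports Defs "HOL-Computational_Algebra.Fundamental_Theorem_Algebra"
begin

section \<open>Traces of square-zero and idempotent maps, and eigenvectors in invariant
  subspaces\<close>

section \<open>Linear algebra\<close>

text \<open>The trace is determined on the range, so \<open>B\<close> need not span the whole space.
  The image of each standard basis vector is expanded in \<open>B\<close>; after swapping the sums,
  linearity reassembles the coordinates of \<open>f b\<close>.\<close>

lemma trace_linear_adapted_basis:
  fixes f :: "'a::field ^ 'n \<Rightarrow> 'a ^ 'n"
  assumes "Vector_Spaces.linear (*s) (*s) f" and ind: "vec.independent B"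
    and range: "range f \<subseteq> vec.span B"
  shows "trace (matrix f) = (\<Sum>b\<in>B. vec.representation B (f b) b)"
proof -
  interpret f: Vector_Spaces.linear "(*s)" "(*s)" f by fact
  have fin: "finite B" using ind by (rule vec.finiteI_independent)
  have expand: "f x = (\<Sum>b\<in>B. vec.representation B (f x) b *s b)" for x
    using vec.sum_representation_eq[OF ind _ fin subset_refl, of "f x"] range
    by (simp add: image_subset_iff)
  have "trace (matrix f) = (\<Sum>k\<in>UNIV. \<Sum>b\<in>B. vec.representation B (f (axis k 1)) b * b $ k)"
  proof -
    have "f (axis k 1) $ k = (\<Sum>b\<in>B. vec.representation B (f (axis k 1)) b * b $ k)" for k
      by (subst expand) simp
    then show ?thesis by (simp add: trace_def matrix_def)
  qed
  also have "\<dots> = (\<Sum>b\<in>B. \<Sum>k\<in>UNIV. b $ k * vec.representation B (f (axis k 1)) b)"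
    by (subst sum.swap) (simp add: mult.commute)
  also have "\<dots> = (\<Sum>b\<in>B. vec.representation B (f b) b)"
  proof (rule sum.cong)
    fix b assume "b \<in> B"
    have "f b = (\<Sum>k\<in>UNIV. b $ k *s f (axis k 1))"
      by (subst basis_expansion[of b, symmetric]) (simp add: f.sum f.scale)
    then have "vec.representation B (f b) =
        (\<lambda>c. \<Sum>k\<in>UNIV. vec.representation B (b $ k *s f (axis k 1)) c)"
      using range by (simp add: image_subset_iff vec.span_scale vec.representation_sum[OF ind])
    then show "(\<Sum>k\<in>UNIV. b $ k * vec.representation B (f (axis k 1)) b) = vec.representation B (f b) b"
      using range by (simp add: image_subset_iff vec.representation_scale[OF ind])
  qed simp
  finally show ?thesis .
qed

lemma trace_square_zero:
  fixes f :: "'a::field ^ 'n \<Rightarrow> 'a ^ 'n"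
  assumes "Vector_Spaces.linear (*s) (*s) f" and "\<And>x. f (f x) = 0"
  shows "trace (matrix f) = 0"
proof -
  obtain B where B: "B \<subseteq> range f" "vec.independent B" "range f \<subseteq> vec.span B"
    by (rule vec.basis_exists[of "range f"]) blast
  have "f b = 0" if "b \<in> B" for b
    using that B(1) assms(2) by auto
  then show ?thesis
    using trace_linear_adapted_basis[OF assms(1) B(2,3)] by (simp add: vec.representation_zero)
qed

text \<open>\<open>f\<close> fixes a basis of its range, so the trace is the rank, a positive
  integer that stays nonzero in characteristic 0.\<close>

lemma trace_idempotent_nonzero:
  fixes f :: "'a::field_char_0 ^ 'n \<Rightarrow> 'a ^ 'n"
  assumes "Vector_Spaces.linear (*s) (*s) f" and "\<And>x. f (f x) = f x" and "f x \<noteq> 0"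
  shows "trace (matrix f) \<noteq> 0"
proof -
  obtain B where B: "B \<subseteq> range f" "vec.independent B" "range f \<subseteq> vec.span B"
    by (rule vec.basis_exists[of "range f"]) blast
  have "f b = b" if "b \<in> B" for b
    using that B(1) assms(2) by auto
  then have "trace (matrix f) = of_nat (card B)"
    using trace_linear_adapted_basis[OF assms(1) B(2,3)] by (simp add: vec.representation_basis[OF B(2)])
  moreover have "B \<noteq> {}" using B(3) assms(3) by (auto simp: image_subset_iff)
  ultimately show ?thesis using vec.finiteI_independent[OF B(2)] by simp
qed

text \<open>There is one more index than the dimension. Dependence of a set ignores repetitions, so
  a repeated vector is a separate case, settled by the relation
  \<open>w i - w j = 0\<close>.\<close>

lemma nontrivial_relation:
  fixes w :: "nat \<Rightarrow> 'a::field ^ 'n"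
  obtains c k where "k \<le> CARD('n)" "c k \<noteq> 0" "(\<Sum>k\<le>CARD('n). c k *s w k) = 0"
proof (cases "inj_on w {..CARD('n)}")
  case True
  have "vec.dependent (w ` {..CARD('n)})"
  proof (rule ccontr)
    assume "vec.independent (w ` {..CARD('n)})"
    then have "card (w ` {..CARD('n)}) \<le> vec.dim (UNIV :: ('a ^ 'n) set)"
      by (rule vec.independent_card_le_dim[rotated]) simp
    then show False by (simp add: card_image[OF True] card_cart_basis)
  qed
  then obtain u k where "k \<le> CARD('n)" "u (w k) \<noteq> 0" "(\<Sum>v\<in>w ` {..CARD('n)}. u v *s v) = 0"
    by (auto simp: vec.dependent_finite)
  then show ?thesis
    by (intro that[of k "\<lambda>k. u (w k)"]) (auto simp: sum.reindex[OF True])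
next
  case False
  then obtain i j where ij: "i \<le> CARD('n)" "j \<le> CARD('n)" "i \<noteq> j" "w i = w j"
    by (auto simp: inj_on_def)
  define c :: "nat \<Rightarrow> 'a" where "c k = (if k = i then 1 else if k = j then -1 else 0)" for k
  have "(\<Sum>k\<le>CARD('n). c k *s w k) = (\<Sum>k\<in>{i, j}. c k *s w k)"
    using ij by (intro sum.mono_neutral_right) (auto simp: c_def)
  also have "\<dots> = 0" using ij by (simp add: c_def)
  finally show ?thesis using ij by (intro that[of i c]) (auto simp: c_def)
qed

text \<open>Take a nonzero polynomial p of least degree with p(f) v = 0 and split off a root, p = (X
  - \<mu>) q. Then q(f) v is nonzero by minimality and is the eigenvector.\<close>

lemma exists_eigenvector:
  fixes f :: "complex ^ 'n \<Rightarrow> complex ^ 'n"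
  assumes "Vector_Spaces.linear (*s) (*s) f" and W: "vec.subspace W"
    and inv: "\<And>x. x \<in> W \<Longrightarrow> f x \<in> W" and v: "v \<in> W" "v \<noteq> 0"
  obtains w \<mu> where "w \<in> W" "w \<noteq> 0" "f w = \<mu> *s w"
proof -
  interpret f: Vector_Spaces.linear "(*s)" "(*s)" f by fact
  let ?N = "CARD('n)"
  \<comment> \<open>\<open>Q p\<close> is p(f) v as long as the degree is at most
    \<open>CARD('n)\<close>; the range of summation is fixed, which is why \<open>P\<close> bounds
    the degree.\<close>
  define Q where "Q p = (\<Sum>k\<le>?N. coeff p k *s (f ^^ k) v)" for p :: "complex poly"
  obtain c k where c: "k \<le> ?N" "c k \<noteq> 0" "(\<Sum>k\<le>?N. c k *s (f ^^ k) v) = 0"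
    by (rule nontrivial_relation)
  define p0 where "p0 = Poly (map c [0..<Suc ?N])"
  have coeff0: "coeff p0 k = (if k \<le> ?N then c k else 0)" for k
    unfolding p0_def coeff_Poly_eq nth_default_def by (auto simp del: upt_Suc)
  define P where "P p \<longleftrightarrow> p \<noteq> 0 \<and> degree p \<le> ?N \<and> Q p = 0" for p
  have "P p0"
    unfolding P_def Q_def using c
    by (auto simp: coeff0 poly_eq_iff intro!: degree_le exI[of _ k])
  then obtain p where p: "P p" and least: "\<And>q. P q \<Longrightarrow> degree p \<le> degree q"
    using ex_has_least_nat[of P p0 degree] by blast
  have "degree p \<noteq> 0"
  proof
    assume "degree p = 0"
    then obtain a where a: "p = [:a:]" by (rule degree_eq_zeroE)
    have "Q p = (\<Sum>k\<in>{0}. coeff p k *s (f ^^ k) v)"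
      unfolding Q_def a by (intro sum.mono_neutral_right) (auto simp: coeff_pCons split: nat.splits)
    then show False using p v(2) by (simp add: P_def a)
  qed
  then obtain \<mu> where "poly p \<mu> = 0"
    using fundamental_theorem_of_algebra[of p] constant_degree[of p] by auto
  then obtain q where q: "p = [:-\<mu>, 1:] * q" by (auto simp: poly_eq_0_iff_dvd)
  then have q0: "q \<noteq> 0" using p by (auto simp: P_def)
  then have deg: "degree p = Suc (degree q)" by (simp add: q degree_mult_eq del: mult_pCons_left)
  have "\<not> P q" using least[of q] deg by auto
  then have "Q q \<noteq> 0" using q0 deg p by (auto simp: P_def)
  moreover have "Q q \<in> W"
  proof -
    have "(f ^^ k) v \<in> W" for k by (induction k) (auto intro: inv v(1))
    then show ?thesis unfolding Q_def using W by (intro vec.subspace_sum vec.subspace_scale)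
  qed
  moreover have "f (Q q) = \<mu> *s Q q"
  proof -
    \<comment> \<open>Applying \<open>f\<close> shifts the coefficients of q by one;
      \<open>top\<close> disposes of the one term that would leave the range of summation.\<close>
    obtain M where M: "?N = Suc M" using gr0_implies_Suc[OF zero_less_card_finite] by blast
    have top: "coeff q (Suc M) = 0" using deg p by (intro coeff_eq_0) (simp add: P_def M)
    have "f (Q q) = (\<Sum>k\<le>Suc M. coeff (pCons 0 q) k *s (f ^^ k) v)"
      unfolding Q_def M sum.atMost_Suc_shift[of "\<lambda>k. coeff (pCons 0 q) k *s (f ^^ k) v" M]
      by (simp add: f.sum f.scale f.add f.zero top)
    moreover have "Q p = (\<Sum>k\<le>Suc M. coeff (pCons 0 q) k *s (f ^^ k) v) - \<mu> *s Q q"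
      unfolding Q_def M vec.scale_sum_right sum_subtractf[symmetric]
      by (intro sum.cong refl) (simp add: q algebra_simps vec.scale_left_diff_distrib)
    ultimately show ?thesis using p by (simp add: P_def)
  qed
  ultimately show ?thesis using that by blast
qed

lemma
  assumes "invertible A"
  shows matrix_inv_right: "A ** matrix_inv A = Finite_Cartesian_Product.mat 1"
    and matrix_inv_left: "matrix_inv A ** A = Finite_Cartesian_Product.mat 1"
proof -
  have "A ** matrix_inv A = Finite_Cartesian_Product.mat 1 \<and> matrix_inv A ** A = Finite_Cartesian_Product.mat 1"
    using assms unfolding invertible_def matrix_inv_def by (rule someI_ex)
  then show "A ** matrix_inv A = Finite_Cartesian_Product.mat 1"
    "matrix_inv A ** A = Finite_Cartesian_Product.mat 1" by auto
qed

lemma basis_vec_expansion: "(\<Sum>i\<in>UNIV. x $ i *s \<phi> i) = x"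
  unfolding basis_vec_def by (rule basis_expansion)

section \<open>The form tr (x y) of the left regular representation, and the unit it
  provides\<close>

section \<open>The trace form of an algebra\<close>

text \<open>The product carries no unit in advance; \<open>unit_exists\<close> constructs one from
  nondegeneracy of the trace form.\<close>

locale complex_algebra =
  fixes mult :: "'n::finite product" (infixl "\<star>" 70)
  assumes bilinear: "complex_bilinear mult"
    and assoc: "x \<star> y \<star> z = x \<star> (y \<star> z)"
begin

lemma linear_left: "Vector_Spaces.linear (*s) (*s) (\<lambda>x. x \<star> y)"
  and linear_right: "Vector_Spaces.linear (*s) (*s) (\<lambda>y. x \<star> y)"
  using bilinear by (auto simp: complex_bilinear_def)

sublocale left: Vector_Spaces.linear "(*s)" "(*s)" "\<lambda>x. x \<star> y" for y by (rule linear_left)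
sublocale right: Vector_Spaces.linear "(*s)" "(*s)" "\<lambda>y. x \<star> y" for x by (rule linear_right)

lemmas mult_linear = left.add left.scale left.sum left.zero left.diff
  right.add right.scale right.sum right.zero right.diff

definition tr :: "complex ^ 'n \<Rightarrow> complex" where
  "tr x = trace (matrix (\<lambda>y. x \<star> y))"

text \<open>By associativity, left multiplication by a product is a composition, so the symmetry of
  the form is that of the matrix trace.\<close>

lemma tr_mult: "tr (x \<star> y) = trace (matrix (\<lambda>z. x \<star> z) ** matrix (\<lambda>z. y \<star> z))"
  unfolding tr_def matrix_compose_gen[OF linear_right linear_right, symmetric]
  by (simp add: assoc[abs_def] o_def)

lemma tr_commute: "tr (x \<star> y) = tr (y \<star> x)"
  unfolding tr_mult by (rule trace_mul_sym)

lemma linear_tr: "Vector_Spaces.linear (*s) (*) tr"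
  by unfold_locales
    (simp_all add: tr_def trace_def matrix_def mult_linear sum.distrib sum_distrib_left algebra_simps)

sublocale tr: Vector_Spaces.linear "(*s)" "(*)" tr by (rule linear_tr)

lemma tr_basis: "tr (\<phi> i \<star> \<phi> j) = algebra_metric mult $ i $ j"
  unfolding tr_mult
  by (simp add: trace_def matrix_def matrix_matrix_mult_def algebra_metric_def struct_const_def
      basis_vec_def) (rule sum.swap)

lemma tr_metric: "tr (x \<star> y) = (\<Sum>i\<in>UNIV. x $ i * (algebra_metric mult *v y) $ i)"
proof -
  have "tr (\<phi> i \<star> y) = (algebra_metric mult *v y) $ i" for i
    by (subst basis_vec_expansion[of y, symmetric])
      (simp only: right.sum right.scale tr.sum tr.scale tr_basis matrix_vector_mult_def
        vec_lambda_beta mult.commute)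
  then show ?thesis
    by (subst (1) basis_vec_expansion[of x, symmetric])
      (simp only: left.sum left.scale tr.sum tr.scale)
qed

lemma metric_symmetric: "algebra_metric mult $ i $ j = algebra_metric mult $ j $ i"
  unfolding tr_basis[symmetric] by (rule tr_commute)

lemma tr_square_zero: "x \<star> x = 0 \<Longrightarrow> tr x = 0"
  unfolding tr_def
  by (rule trace_square_zero[OF linear_right]) (simp add: assoc[symmetric] mult_linear)

lemma tr_idempotent_nonzero: "x \<star> x = x \<Longrightarrow> x \<noteq> 0 \<Longrightarrow> tr x \<noteq> 0"
  unfolding tr_def
  by (rule trace_idempotent_nonzero[OF linear_right, of _ x]) (simp_all add: assoc[symmetric])

lemma metric_invertibleI:
  assumes "\<And>x. (\<And>y. tr (y \<star> x) = 0) \<Longrightarrow> x = 0"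
  shows "invertible (algebra_metric mult)"
  unfolding invertible_left_inverse matrix_left_invertible_ker
  using assms by (simp add: tr_metric)

end

text \<open>The Frobenius form is the trace form itself. This excludes algebras such as C[t]/(t^2),
  which carry a nondegenerate form although their trace form degenerates.\<close>

locale frobenius_algebra = complex_algebra mult
  for mult :: "'n::finite product" (infixl "\<star>" 70) +
  assumes metric_invertible: "invertible (algebra_metric mult)"
begin

lemma tr_nondegenerate: "\<exists>y. tr (x \<star> y) \<noteq> 0" if "x \<noteq> 0"
proof (rule ccontr)
  assume *: "\<nexists>y. tr (x \<star> y) \<noteq> 0"
  have "(algebra_metric mult *v x) $ i = 0" for i
  proof -
    have "tr (\<phi> i \<star> x) = 0" using * by (simp add: tr_commute[of _ x])
    then show ?thesis
      by (simp add: tr_metric basis_vec_def axis_def if_distrib if_distribR cong: if_cong)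
  qed
  then have "algebra_metric mult *v x = 0" by (simp add: Finite_Cartesian_Product.vec_eq_iff)
  moreover have "\<forall>x. algebra_metric mult *v x = 0 \<longrightarrow> x = 0"
    using metric_invertible unfolding invertible_left_inverse matrix_left_invertible_ker .
  ultimately show False using that by auto
qed

lemma tr_eqI: "x = y" if "\<And>z. tr (x \<star> z) = tr (y \<star> z)"
  using tr_nondegenerate[of "x - y"] that by (auto simp: mult_linear tr.diff)

text \<open>The inverse Gram matrix turns the coefficient vector \<open>a\<close> of a linear
  functional into the element representing it.\<close>

lemma tr_represent:
  obtains x where "\<And>y. tr (x \<star> y) = (\<Sum>k\<in>UNIV. a $ k * y $ k)"
proof -
  let ?x = "matrix_inv (algebra_metric mult) *v a"
  have "tr (?x \<star> y) = (\<Sum>k\<in>UNIV. a $ k * y $ k)" for y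
  proof -
    have "algebra_metric mult *v ?x = a"
      by (simp add: matrix_vector_mul_assoc matrix_inv_right metric_invertible)
    then show ?thesis
      unfolding tr_commute[of ?x y] unfolding tr_metric by (simp add: mult.commute)
  qed
  then show ?thesis by (rule that)
qed

text \<open>\<open>u\<close> represents \<open>tr\<close> itself, so tr (u x z) = tr (x z) for all
  z, and nondegeneracy cancels z. For the right unit, cyclicity first moves \<open>u\<close> to the
  front.\<close>

lemma unit_exists: obtains u where "\<And>x. u \<star> x = x" "\<And>x. x \<star> u = x"
proof -
  obtain u where u: "\<And>y. tr (u \<star> y) = (\<Sum>k\<in>UNIV. (\<chi> k. tr (\<phi> k)) $ k * y $ k)"
    using tr_represent by blast
  have u': "tr (u \<star> y) = tr y" for y
    using u[of y] by (subst (2) basis_vec_expansion[of y, symmetric])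
      (simp add: tr.sum tr.scale mult.commute)
  have "u \<star> x = x" for x
    by (rule tr_eqI) (simp add: assoc u')
  moreover have "x \<star> u = x" for x
  proof (rule tr_eqI)
    fix z show "tr (x \<star> u \<star> z) = tr (x \<star> z)"
      using tr_commute[of x "u \<star> z"] by (simp add: assoc u' tr_commute)
  qed
  ultimately show ?thesis by (rule that)
qed

end

section \<open>Primitive idempotents, dual bases of their left ideals, and maximal orthogonal
  families\<close>

section \<open>Primitive idempotents\<close>

context frobenius_algebra
begin

text \<open>The corner e R e consists of scalar multiples of e, so numbers can be read off from
  products e x e.\<close>

definition primitive :: "complex ^ 'n \<Rightarrow> bool" where
  "primitive e \<longleftrightarrow> e \<noteq> 0 \<and> e \<star> e = e \<and> (\<forall>x. \<exists>c. e \<star> x \<star> e = c *s e)"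

text \<open>Brauer's argument in a minimal left ideal. Keeping that ideal inside R x makes the
  idempotent a left multiple of \<open>x\<close>, which the maximality argument for orthogonal
  families needs.\<close>

lemma primitive_left_multiple:
  assumes "x \<noteq> 0"
  obtains s where "primitive (s \<star> x)"
proof -
  \<comment> \<open>Nonzero left ideals, so that one of least dimension is minimal.\<close>
  define ideal where "ideal I \<longleftrightarrow> vec.subspace I \<and> (\<forall>s. \<forall>y\<in>I. s \<star> y \<in> I) \<and> I \<noteq> {0}" for I
  obtain u where u: "\<And>x. u \<star> x = x" "\<And>x. x \<star> u = x" using unit_exists by blast
  have principal: "ideal ((\<lambda>s. s \<star> v) ` I)" if "ideal I" "w \<in> I" "w \<star> v \<noteq> 0" for I v w
    unfolding ideal_def
  proof (intro conjI)
    show "vec.subspace ((\<lambda>s. s \<star> v) ` I)"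
      using that(1) by (auto simp: ideal_def intro: left.subspace_image)
    show "\<forall>s. \<forall>y\<in>(\<lambda>s. s \<star> v) ` I. s \<star> y \<in> (\<lambda>s. s \<star> v) ` I"
      using that(1) by (auto simp: ideal_def assoc[symmetric])
    show "(\<lambda>s. s \<star> v) ` I \<noteq> {0}" using that(2,3) by auto
  qed
  have whole: "ideal UNIV"
    using assms by (auto simp: ideal_def)
  let ?P = "\<lambda>I. ideal I \<and> I \<subseteq> range (\<lambda>s. s \<star> x)"
  have "?P (range (\<lambda>s. s \<star> x))"
    using principal[OF whole, of u x] assms u by simp
  from ex_has_least_nat[of ?P, OF this, of vec.dim]
  obtain K where K: "ideal K" "K \<subseteq> range (\<lambda>s. s \<star> x)"
    and least: "\<And>I. ?P I \<Longrightarrow> vec.dim K \<le> vec.dim I"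
    by auto
  have closed: "s \<star> y \<in> K" if "y \<in> K" for s y using K(1) that by (auto simp: ideal_def)
  have minimal: "I = K" if "ideal I" "I \<subseteq> K" for I
    using that K least[of I] by (intro vec.subspace_dim_equal) (auto simp: ideal_def)
  have "0 \<in> K" using K(1) by (auto simp: ideal_def vec.subspace_0)
  then obtain z where z: "z \<in> K" "z \<noteq> 0" using K(1) by (auto simp: ideal_def)
  obtain y where y: "tr (z \<star> y) \<noteq> 0" using tr_nondegenerate z(2) by blast
  \<comment> \<open>This choice gives K b \<noteq> 0: if z b were 0, then (z y)(z y) = (z b) y would
    vanish, against tr (z y) \<noteq> 0.\<close>
  define b where "b = y \<star> z"
  have b: "b \<in> K" unfolding b_def using z(1) by (rule closed)
  have zb: "z \<star> b \<noteq> 0"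
  proof
    assume "z \<star> b = 0"
    then have "(z \<star> y) \<star> (z \<star> y) = 0" by (simp add: b_def assoc[symmetric] mult_linear)
    then show False using y tr_square_zero by blast
  qed
  \<comment> \<open>By minimality K b = K; a preimage of \<open>b\<close> itself is the candidate
    for the idempotent.\<close>
  have "(\<lambda>w. w \<star> b) ` K = K"
    using principal[OF K(1) z(1) zb] closed[OF b] by (intro minimal) auto
  then obtain e where e: "e \<in> K" "e \<star> b = b" using b by (metis imageE)
  have e0: "e \<noteq> 0" using e(2) zb by (auto simp: mult_linear)
  \<comment> \<open>Right multiplication by \<open>b\<close> is injective on \<open>K\<close>, since
    its kernel is closed under left multiplication and misses \<open>z\<close>. Applied to e e - e
    this gives idempotency.\<close>
  have annihilator: "w = 0" if "w \<in> K" "w \<star> b = 0" for w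
  proof (rule ccontr)
    assume "w \<noteq> 0"
    have "ideal {w \<in> K. w \<star> b = 0}"
      unfolding ideal_def
    proof (intro conjI)
      show "vec.subspace {w \<in> K. w \<star> b = 0}"
        using K(1) by (auto simp: ideal_def vec.subspace_def mult_linear)
      show "\<forall>s. \<forall>y\<in>{w \<in> K. w \<star> b = 0}. s \<star> y \<in> {w \<in> K. w \<star> b = 0}"
        using closed by (auto simp: assoc mult_linear)
      show "{w \<in> K. w \<star> b = 0} \<noteq> {0}" using that \<open>w \<noteq> 0\<close> by auto
    qed
    then have "{w \<in> K. w \<star> b = 0} = K" by (rule minimal) auto
    then show False using z(1) zb by auto
  qed
  have "e \<star> e - e \<in> K"
    using K(1) closed[OF e(1)] e(1) unfolding ideal_def by (blast intro: vec.subspace_diff)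
  then have "e \<star> e - e = 0"
    by (rule annihilator) (simp add: left.diff assoc e(2))
  then have idem: "e \<star> e = e" by simp
  \<comment> \<open>A nonzero element of the corner e R e generates \<open>K\<close> by minimality,
    so some left multiple of it is \<open>e\<close>.\<close>
  have inverse: "\<exists>s. s \<star> v = e" if "e \<star> v \<star> e = v" "v \<noteq> 0" for v
  proof -
    have "v \<in> K" using closed[OF e(1), of "e \<star> v"] that(1) by simp
    then have "range (\<lambda>s. s \<star> v) = K"
      using principal[OF whole, of u v] u that(2) closed by (intro minimal) auto
    then show ?thesis using e(1) by (metis rangeE)
  qed
  \<comment> \<open>Schur's lemma: left multiplication by \<open>?t\<close> has an eigenvector
    \<open>w\<close> in e R e. If \<open>?t - \<mu> *s e\<close>, which annihilates
    \<open>w\<close>, were nonzero, it would be left invertible, forcing w = 0.\<close>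
  have "\<exists>c. e \<star> r \<star> e = c *s e" for r
  proof -
    let ?W = "{w. e \<star> w \<star> e = w}" and ?t = "e \<star> r \<star> e"
    have idem': "e \<star> (e \<star> w) = e \<star> w" for w by (simp add: assoc[symmetric] idem)
    have peirce: "e \<star> w = w" "w \<star> e = w" if "w \<in> ?W" for w
    proof -
      have w: "e \<star> w \<star> e = w" using that by simp
      have "e \<star> (e \<star> w \<star> e) = e \<star> w \<star> e" "e \<star> w \<star> e \<star> e = e \<star> w \<star> e"
        by (simp_all add: assoc idem idem')
      then show "e \<star> w = w" "w \<star> e = w" unfolding w .
    qed
    have "vec.subspace ?W" by (auto simp: vec.subspace_def mult_linear)
    moreover have "?t \<star> w \<in> ?W" if "w \<in> ?W" for w
      using peirce(2)[OF that] by (simp add: assoc idem')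
    ultimately obtain w \<mu> where w: "w \<in> ?W" "w \<noteq> 0" "?t \<star> w = \<mu> *s w"
      using exists_eigenvector[OF linear_right, of ?W ?t e] e0 idem by auto
    have ew: "e \<star> w = w" using w(1) by (rule peirce)
    have "?t - \<mu> *s e = 0"
    proof (rule ccontr)
      assume "?t - \<mu> *s e \<noteq> 0"
      then obtain s where "s \<star> (?t - \<mu> *s e) = e"
        using inverse[of "?t - \<mu> *s e"] by (auto simp: mult_linear assoc idem idem')
      then have "w = s \<star> ((?t - \<mu> *s e) \<star> w)" by (simp only: assoc[symmetric] ew)
      also have "(?t - \<mu> *s e) \<star> w = 0" unfolding left.diff left.scale w(3) ew by simp
      finally show False using w(2) by (simp add: mult_linear)
    qed
    then show ?thesis by auto
  qed
  then have "primitive e" using e0 idem by (auto simp: primitive_def)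
  then show ?thesis using e(1) K(2) that by auto
qed

text \<open>The last clause is a resolution of the identity on R e; it expresses that the
  \<open>y i\<close> span R e in a form that can be inserted between factors of a product.\<close>

definition dual_bases ::
    "complex ^ 'n \<Rightarrow> nat \<Rightarrow> (nat \<Rightarrow> complex ^ 'n) \<Rightarrow> (nat \<Rightarrow> complex ^ 'n) \<Rightarrow> bool" where
  "dual_bases e d x y \<longleftrightarrow> 0 < d \<and> (\<forall>i<d. e \<star> x i = x i) \<and> (\<forall>i<d. y i \<star> e = y i) \<and>
     (\<forall>i<d. \<forall>j<d. x i \<star> y j = (if i = j then e else 0)) \<and>
     (\<forall>v. v \<star> e = v \<longrightarrow> (\<Sum>k<d. y k \<star> (x k \<star> v)) = v)"

text \<open>Coordinate functionals of a basis of R e are represented through the trace form;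
  multiplying the representing elements by \<open>e\<close> and by the scalar tr e gives the dual
  family.\<close>

lemma primitive_dual_bases:
  assumes "primitive e"
  obtains d x y where "dual_bases e d x y"
proof -
  have e: "e \<noteq> 0" "e \<star> e = e" and scalar: "\<And>r. \<exists>c. e \<star> r \<star> e = c *s e"
    using assms by (auto simp: primitive_def)
  have tr_e: "tr e \<noteq> 0" using tr_idempotent_nonzero e by blast
  obtain B where B: "B \<subseteq> {v. v \<star> e = v}" "vec.independent B" "{v. v \<star> e = v} \<subseteq> vec.span B"
    by (rule vec.basis_exists) blast
  have fin: "finite B" using B(2) by (rule vec.finiteI_independent)
  have "B \<noteq> {}" using B(3) e by auto
  obtain h where h: "bij_betw h {..<card B} B"
    using ex_bij_betw_nat_finite[OF fin] by (auto simp: atLeast0LessThan)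
  have "\<exists>X. e \<star> X = X \<and> (\<forall>b'\<in>B. X \<star> b' = (if b = b' then e else 0))" if "b \<in> B" for b
  proof -
    \<comment> \<open>\<open>g\<close> is the coordinate functional of \<open>b\<close>, stored in
      one arbitrary component, \<open>undefined\<close>, of a vector-valued map.\<close>
    obtain g where "Vector_Spaces.linear (*s) (*s) g"
      and g: "\<And>b'. b' \<in> B \<Longrightarrow> g b' = (if b = b' then \<phi> undefined else (0 :: complex ^ 'n))"
      using vec.linear_independent_extend[OF B(2), of "\<lambda>b'. if b = b' then \<phi> undefined else 0"]
      by blast
    interpret g: Vector_Spaces.linear "(*s)" "(*s)" g by fact
    obtain X where X: "\<And>y. tr (X \<star> y) = (\<Sum>k\<in>UNIV. (\<chi> k. g (\<phi> k) $ undefined) $ k * y $ k)"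
      using tr_represent by blast
    have trX: "tr (X \<star> v) = g v $ undefined" for v
      unfolding X by (subst (2) basis_vec_expansion[of v, symmetric])
        (simp add: g.sum g.scale mult.commute)
    \<comment> \<open>Primitivity makes the product a multiple c e, and the trace determines the
      factor: c tr e = tr (X b').\<close>
    have "e \<star> X \<star> b' = (if b = b' then 1 / tr e else 0) *s e" if b': "b' \<in> B" for b'
    proof -
      have "b' \<star> e = b'" using B(1) b' by auto
      then obtain c where c: "e \<star> X \<star> b' = c *s e"
        using scalar[of "X \<star> b'"] by (auto simp: assoc)
      have "c * tr e = tr (X \<star> b')"
        using arg_cong[OF c, of tr] tr_commute[of e "X \<star> b'"] \<open>b' \<star> e = b'\<close>
        by (simp add: tr.scale assoc)
      then show ?thesis
        using tr_e by (auto simp: c trX g[OF b'] basis_vec_def field_simps)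
    qed
    then show ?thesis
      using tr_e by (intro exI[of _ "tr e *s (e \<star> X)"]) (auto simp: mult_linear assoc[symmetric] e)
  qed
  then obtain X where X: "\<And>b. b \<in> B \<Longrightarrow> e \<star> X b = X b"
    "\<And>b b'. b \<in> B \<Longrightarrow> b' \<in> B \<Longrightarrow> X b \<star> b' = (if b = b' then e else 0)"
    by metis
  have complete: "(\<Sum>b\<in>B. b \<star> (X b \<star> v)) = v" if "v \<star> e = v" for v
  proof -
    have "v \<in> vec.span B" using B(3) that by auto
    then obtain c where c: "v = (\<Sum>b\<in>B. c b *s b)" using vec.span_finite[OF fin] by auto
    have "b \<star> (X b \<star> v) = c b *s b" if "b \<in> B" for b
    proof -
      have "X b \<star> v = (\<Sum>b'\<in>B. if b' = b then c b *s e else 0)"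
        unfolding c mult_linear using that by (intro sum.cong) (auto simp: X)
      also have "\<dots> = c b *s e" using that fin by simp
      finally show ?thesis using that B(1) by (auto simp: mult_linear)
    qed
    then show ?thesis by (simp add: c cong: sum.cong)
  qed
  have hB: "h i \<in> B" if "i < card B" for i using h that by (auto simp: bij_betw_def)
  have hinj: "h i = h j \<longleftrightarrow> i = j" if "i < card B" "j < card B" for i j
    using h that by (auto simp: bij_betw_def inj_on_def)
  have "dual_bases e (card B) (\<lambda>i. X (h i)) h"
    unfolding dual_bases_def
  proof (intro conjI allI impI)
    show "0 < card B" using fin \<open>B \<noteq> {}\<close> by (simp add: card_gt_0_iff)
    show "(\<Sum>k<card B. h k \<star> (X (h k) \<star> v)) = v" if "v \<star> e = v" for v
      using sum.reindex_bij_betw[OF h, of "\<lambda>b. b \<star> (X b \<star> v)"] complete[OF that] by simp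
    show "h i \<star> e = h i" if "i < card B" for i using hB[OF that] B(1) by auto
  qed (auto simp: X hB hinj)
  then show ?thesis by (rule that)
qed

text \<open>A family of largest size works: an \<open>x\<close> that is nonzero but acts as 0 on
  every R e has a primitive left multiple, which would enlarge the family.\<close>

lemma complete_primitive_family:
  obtains F where "finite F" and "\<And>e. e \<in> F \<Longrightarrow> primitive e"
    and "\<And>e f r. e \<in> F \<Longrightarrow> f \<in> F \<Longrightarrow> e \<noteq> f \<Longrightarrow> e \<star> r \<star> f = 0"
    and "\<And>x. (\<And>e s. e \<in> F \<Longrightarrow> x \<star> s \<star> e = 0) \<Longrightarrow> x = 0"
proof -
  define orth where "orth F \<longleftrightarrow> (\<forall>e\<in>F. primitive e) \<and>
    (\<forall>e\<in>F. \<forall>f\<in>F. e \<noteq> f \<longrightarrow> (\<forall>r. e \<star> r \<star> f = 0))" for F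
  \<comment> \<open>Independence bounds the size by the dimension. Multiplying a relation by
    \<open>w\<close> leaves only its own term, because w v = w w v = 0.\<close>
  have indep: "vec.independent F" if "orth F" for F
    unfolding vec.independent_explicit_finite_subsets
  proof (intro allI impI ballI)
    fix S u w assume S: "S \<subseteq> F" "finite S" "(\<Sum>v\<in>S. u v *s v) = 0" and w: "w \<in> S"
    have idem: "w \<star> w = w" "w \<noteq> 0" using that S(1) w by (auto simp: orth_def primitive_def)
    have "w \<star> v = 0" if "v \<in> S" "w \<noteq> v" for v
      using \<open>orth F\<close> S(1) w that idem(1) unfolding orth_def by (metis subsetD)
    then have "w \<star> (\<Sum>v\<in>S. u v *s v) = (\<Sum>v\<in>S. if v = w then u w *s w else 0)"
      unfolding mult_linear by (intro sum.cong) (auto simp: idem)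
    then show "u w = 0" using S w idem(2) by (simp add: mult_linear)
  qed
  have bound: "card F \<le> CARD('n)" if "orth F" for F
    using vec.independent_card_le_dim[OF subset_UNIV indep[OF that]] by (simp add: card_cart_basis)
  have "\<exists>F. orth F \<and> (\<forall>G. orth G \<longrightarrow> card G \<le> card F)"
    by (rule ex_has_greatest_nat[of orth "{}" _ "Suc CARD('n)"])
      (simp_all add: orth_def[of "{}"] bound less_Suc_eq_le)
  then obtain F where F: "orth F" and max: "\<And>G. orth G \<Longrightarrow> card G \<le> card F"
    by auto
  have fin: "finite F" using indep[OF F] by (rule vec.finiteI_independent)
  have "x = 0" if kill: "\<And>e s. e \<in> F \<Longrightarrow> x \<star> s \<star> e = 0" for x
  proof (rule ccontr)
    assume "x \<noteq> 0"
    then obtain s where s: "primitive (s \<star> x)" by (rule primitive_left_multiple)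
    let ?e = "s \<star> x"
    have right: "?e \<star> r \<star> f = 0" if "f \<in> F" for f r
      using kill[OF that, of r] by (simp add: assoc mult_linear)
    \<comment> \<open>Cyclicity reduces this order to the other one: tr (f r e t) = tr (r (e t f)) =
      0 for every t, where e is \<open>?e\<close>.\<close>
    have left: "f \<star> r \<star> ?e = 0" if "f \<in> F" for f r
    proof (rule ccontr)
      assume "f \<star> r \<star> ?e \<noteq> 0"
      then obtain t where "tr (f \<star> r \<star> ?e \<star> t) \<noteq> 0" using tr_nondegenerate by blast
      moreover have "tr (f \<star> r \<star> ?e \<star> t) = tr (r \<star> (?e \<star> t \<star> f))"
        using tr_commute[of f "r \<star> ?e \<star> t"] by (simp add: assoc)
      ultimately show False using right[OF that, of t] by (simp add: mult_linear tr.zero)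
    qed
    have "?e \<notin> F"
      using s right[of ?e ?e] by (auto simp: primitive_def)
    moreover have "orth (insert ?e F)"
      using F s left right by (auto simp: orth_def)
    ultimately show False using max[of "insert ?e F"] fin by simp
  qed
  then show ?thesis
  proof (rule that[OF fin, rotated 2])
    show "primitive e" if "e \<in> F" for e using F that by (simp add: orth_def)
    show "e \<star> r \<star> f = 0" if "e \<in> F" "f \<in> F" "e \<noteq> f" for e f r
      using F that by (simp add: orth_def)
  qed
qed

end

section \<open>From a nondegenerate trace form to a product of matrix algebras\<close>

section \<open>The Wedderburn decomposition\<close>

context frobenius_algebra
begin

theorem semisimple: "semisimple_algebra mult"
proof -
  obtain F where F: "finite F" and prim: "\<And>e. e \<in> F \<Longrightarrow> primitive e"
    and orth: "\<And>e f r. e \<in> F \<Longrightarrow> f \<in> F \<Longrightarrow> e \<noteq> f \<Longrightarrow> e \<star> r \<star> f = 0"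
    and faithful: "\<And>x. (\<And>e s. e \<in> F \<Longrightarrow> x \<star> s \<star> e = 0) \<Longrightarrow> x = 0"
    by (rule complete_primitive_family) blast
  define r where "r = card F"
  obtain h where h: "bij_betw h {..<r} F"
    using ex_bij_betw_nat_finite[OF F] by (auto simp: atLeast0LessThan r_def)
  have hF: "h b \<in> F" if "b < r" for b using h that by (auto simp: bij_betw_def)
  have hinj: "h b = h c \<longleftrightarrow> b = c" if "b < r" "c < r" for b c
    using h that by (auto simp: bij_betw_def inj_on_def)
  have "\<exists>d x y. dual_bases (h b) d x y" if "b < r" for b
    using primitive_dual_bases[OF prim[OF hF[OF that]]] by blast
  then obtain d x y where D: "\<And>b. b < r \<Longrightarrow> dual_bases (h b) (d b) (x b) (y b)"
    by metis
  have d: "0 < d b" if "b < r" for b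
    using D[OF that] by (simp add: dual_bases_def)
  have x: "h b \<star> x b i = x b i" and y: "y b i \<star> h b = y b i" if "b < r" "i < d b" for b i
    using D[OF that(1)] that(2) by (simp_all add: dual_bases_def)
  have dual: "x b i \<star> y b j = (if i = j then h b else 0)" if "b < r" "i < d b" "j < d b" for b i j
    using D[OF that(1)] that(2,3) by (simp add: dual_bases_def)
  have complete: "(\<Sum>k<d b. y b k \<star> (x b k \<star> v)) = v" if "b < r" "v \<star> h b = v" for b v
    using D[OF that(1)] that(2) by (simp add: dual_bases_def)
  have idem: "h b \<star> h b = h b" "h b \<noteq> 0" if "b < r" for b
    using prim[OF hF[OF that]] by (auto simp: primitive_def)
  have tr_h: "tr (h b) \<noteq> 0" if "b < r" for b
    using tr_idempotent_nonzero idem[OF that] by blast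
  have h_scale: "c = c'" if "c *s h b = c' *s h b" "b < r" for c c' b
    using that idem by auto
  \<comment> \<open>Pulling the idempotents to the outside places the product in h_b R h_c, which is
    0 for distinct members.\<close>
  have cross: "x b i \<star> y c j = 0" if "b < r" "c < r" "b \<noteq> c" "i < d b" "j < d c" for b c i j
  proof -
    have "x b i \<star> y c j = h b \<star> x b i \<star> (y c j \<star> h c)" using that by (simp add: x y)
    also have "\<dots> = h b \<star> (x b i \<star> y c j) \<star> h c" by (simp add: assoc)
    also have "\<dots> = 0" using that hF hinj by (intro orth) auto
    finally show ?thesis .
  qed

  \<comment> \<open>The (i, j) entry of \<open>v\<close> acting on the left ideal R h_b. Defining it
    by the trace makes linearity immediate; primitivity then identifies it with the scalar in
    \<open>x b i \<star> v \<star> y b j\<close>.\<close>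
  define coef where "coef b i j v = tr (x b i \<star> v \<star> y b j) / tr (h b)" for b i j v
  have coef: "x b i \<star> v \<star> y b j = coef b i j v *s h b"
    if "b < r" "i < d b" "j < d b" for b i j v
  proof -
    have "x b i \<star> v \<star> y b j = (h b \<star> x b i) \<star> v \<star> (y b j \<star> h b)" using that by (simp add: x y)
    also have "\<dots> = h b \<star> (x b i \<star> v \<star> y b j) \<star> h b" by (simp add: assoc)
    also obtain c where "\<dots> = c *s h b"
      using prim[OF hF[OF \<open>b < r\<close>]] unfolding primitive_def by blast
    finally show ?thesis using tr_h[OF that(1)] by (simp add: coef_def tr.scale)
  qed
  have coef_linear: "coef b i j (v + w) = coef b i j v + coef b i j w"
    "coef b i j (c *s v) = c * coef b i j v" for b i j v w c
    by (simp_all add: coef_def mult_linear tr.add tr.scale add_divide_distrib)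
  have coef_mult: "coef b i j (v \<star> w) = (\<Sum>k<d b. coef b i k v * coef b k j w)"
    if "b < r" "i < d b" "j < d b" for b i j v w
  proof -
    \<comment> \<open>Inserting the resolution of the identity between \<open>v\<close> and
      \<open>w\<close> produces the sum of a matrix product.\<close>
    have wy: "w \<star> y b j = (\<Sum>k<d b. y b k \<star> (x b k \<star> (w \<star> y b j)))"
      using that by (intro complete[symmetric]) (simp_all add: assoc y)
    have "x b i \<star> (v \<star> w) \<star> y b j = x b i \<star> v \<star> (w \<star> y b j)" by (simp add: assoc)
    also have "\<dots> = (\<Sum>k<d b. (x b i \<star> v \<star> y b k) \<star> (x b k \<star> w \<star> y b j))"
      by (subst wy) (simp add: right.sum assoc)
    also have "\<dots> = (\<Sum>k<d b. coef b i k v * coef b k j w) *s h b"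
      unfolding vec.scale_sum_left using that
      by (intro sum.cong) (auto simp: coef mult_linear idem mult.commute)
    finally show ?thesis using coef[OF that] h_scale that(1) by metis
  qed

  define \<Phi> where "\<Phi> v = (\<lambda>b\<in>{..<r}. Matrix.mat (d b) (d b) (\<lambda>(i, j). coef b i j v))" for v
  have \<Phi>: "\<Phi> v b = Matrix.mat (d b) (d b) (\<lambda>(i, j). coef b i j v)" if "b < r" for b v
    using that by (simp add: \<Phi>_def)
  have "inj \<Phi>"
  proof (rule injI)
    fix v w assume eq: "\<Phi> v = \<Phi> w"
    have same: "coef b i j v = coef b i j w" if "b < r" "i < d b" "j < d b" for b i j
      using arg_cong[OF fun_cong[OF eq, of b], of "\<lambda>M. M $$ (i, j)"] that by (simp add: \<Phi>)
    have "v - w = 0"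
    proof (rule faithful)
      fix e s assume "e \<in> F"
      then obtain b where b: "b < r" "e = h b" using h by (auto simp: bij_betw_def)
      \<comment> \<open>Equal entries give x_k (v - w) y_j = 0, and the resolution of the identity
        recovers (v - w) y_j. Since the y_j span R h_b, the difference kills that ideal.\<close>
      have "(v - w) \<star> y b j = 0" if j: "j < d b" for j
      proof -
        have "(v - w) \<star> y b j = (\<Sum>k<d b. y b k \<star> (x b k \<star> ((v - w) \<star> y b j)))"
          using b j by (intro complete[symmetric]) (simp_all add: assoc y)
        also have "\<dots> = (\<Sum>k<d b. y b k \<star> (x b k \<star> v \<star> y b j - x b k \<star> w \<star> y b j))"
          by (simp add: assoc mult_linear)
        also have "\<dots> = 0" using b j by (simp add: coef same mult_linear)
        finally show ?thesis .
      qed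
      moreover have se: "s \<star> e = (\<Sum>k<d b. y b k \<star> (x b k \<star> (s \<star> e)))"
        using b by (intro complete[symmetric]) (simp_all add: assoc idem)
      have "(v - w) \<star> (s \<star> e) = (\<Sum>k<d b. ((v - w) \<star> y b k) \<star> (x b k \<star> (s \<star> e)))"
        by (subst se) (simp add: right.sum assoc)
      ultimately show "(v - w) \<star> s \<star> e = 0" by (simp add: assoc left.zero)
    qed
    then show "v = w" by simp
  qed
  moreover have "\<Phi> ` UNIV = (\<Pi>\<^sub>E b\<in>{..<r}. carrier_mat (d b) (d b))"
  proof
    show "\<Phi> ` UNIV \<subseteq> (\<Pi>\<^sub>E b\<in>{..<r}. carrier_mat (d b) (d b))" by (auto simp: \<Phi>_def)
    show "(\<Pi>\<^sub>E b\<in>{..<r}. carrier_mat (d b) (d b)) \<subseteq> \<Phi> ` UNIV"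
    proof
      fix M :: "nat \<Rightarrow> complex mat"
      assume M: "M \<in> (\<Pi>\<^sub>E b\<in>{..<r}. carrier_mat (d b) (d b))"
      \<comment> \<open>The products y_i x_j act as the matrix units of their block.\<close>
      define v where "v = (\<Sum>b<r. \<Sum>i<d b. \<Sum>j<d b. M b $$ (i, j) *s (y b i \<star> x b j))"
      have "coef c k l v = M c $$ (k, l)" if "c < r" "k < d c" "l < d c" for c k l
      proof -
        have single: "x c k \<star> (y b i \<star> x b j) \<star> y c l = (if b = c \<and> i = k \<and> j = l then h c else 0)"
          if "b < r" "i < d b" "j < d b" for b i j
        proof -
          have "x c k \<star> (y b i \<star> x b j) \<star> y c l = (x c k \<star> y b i) \<star> (x b j \<star> y c l)"
            by (simp add: assoc)
          then show ?thesis
            using that \<open>c < r\<close> \<open>k < d c\<close> \<open>l < d c\<close>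
            by (cases "b = c") (auto simp: dual cross idem mult_linear)
        qed
        have "x c k \<star> v \<star> y c l =
            (\<Sum>b<r. \<Sum>i<d b. \<Sum>j<d b. M b $$ (i, j) *s (x c k \<star> (y b i \<star> x b j) \<star> y c l))"
          by (simp add: v_def mult_linear)
        also have "\<dots> = (\<Sum>b<r. \<Sum>i<d b. \<Sum>j<d b.
            if j = l then (if i = k then (if b = c then M c $$ (k, l) *s h c else 0) else 0) else 0)"
          by (intro sum.cong refl) (auto simp: single)
        also have "\<dots> = (\<Sum>b<r. if b = c then M c $$ (k, l) *s h c else 0)"
        proof (rule sum.cong)
          \<comment> \<open>The indices \<open>k\<close> and \<open>l\<close> are known to be in
            range only in block \<open>c\<close>, hence the case distinction.\<close>
          fix b assume "b \<in> {..<r}"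
          show "(\<Sum>i<d b. \<Sum>j<d b. if j = l then (if i = k then
              (if b = c then M c $$ (k, l) *s h c else 0) else 0) else 0) =
            (if b = c then M c $$ (k, l) *s h c else 0)"
            using \<open>k < d c\<close> \<open>l < d c\<close> by (cases "b = c") (auto intro!: sum.neutral)
        qed simp
        also have "\<dots> = M c $$ (k, l) *s h c" using \<open>c < r\<close> by simp
        finally show ?thesis using coef[OF that] h_scale that(1) by metis
      qed
      then have "\<Phi> v b = M b" for b
        using M by (cases "b < r") (auto simp: \<Phi>_def PiE_def Pi_def extensional_def intro!: eq_matI)
      then have "\<Phi> v = M" by blast
      then show "M \<in> \<Phi> ` UNIV" by blast
    qed
  qed
  ultimately have "bij_betw \<Phi> UNIV (\<Pi>\<^sub>E b\<in>{..<r}. carrier_mat (d b) (d b))"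
    by (simp add: bij_betw_def)
  moreover have "\<Phi> (v + w) b = \<Phi> v b + \<Phi> w b" "\<Phi> (c *s v) b = c \<cdot>\<^sub>m \<Phi> v b"
    "\<Phi> (v \<star> w) b = \<Phi> v b * \<Phi> w b" if "b < r" for v w c b
    using that by (auto simp: \<Phi> coef_linear coef_mult scalar_prod_def atLeast0LessThan intro!: eq_matI)
  ultimately have "matrix_algebra_iso mult r d \<Phi>" by (simp add: matrix_algebra_iso_def)
  then show ?thesis unfolding semisimple_algebra_def using d bilinear assoc by blast
qed

end

section \<open>Matrix units, and nondegeneracy of the trace form of a product of matrix
  algebras\<close>

definition unit_mat :: "nat \<Rightarrow> nat \<Rightarrow> nat \<Rightarrow> 'a::semiring_1 mat" where
  "unit_mat n p q = Matrix.mat n n (\<lambda>(i, j). if i = p \<and> j = q then 1 else 0)"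

lemma unit_mat_carrier [simp]: "unit_mat n p q \<in> carrier_mat n n"
  by (simp add: unit_mat_def)

lemma unit_mat_mult_left:
  assumes "M \<in> carrier_mat n n" "i < n" "j < n" "q < n"
  shows "(unit_mat n p q * M) $$ (i, j) = (if i = p then M $$ (q, j) else 0)"
  using assms
  by (auto simp: unit_mat_def scalar_prod_def atLeast0LessThan if_distrib[where f = "\<lambda>z. z * c" for c]
      cong: if_cong)

lemma unit_mat_mult_right:
  assumes "M \<in> carrier_mat n n" "i < n" "j < n" "p < n"
  shows "(M * unit_mat n p q) $$ (i, j) = (if j = q then M $$ (i, p) else 0)"
  using assms
  by (auto simp: unit_mat_def scalar_prod_def atLeast0LessThan if_distrib[of "(*) _"] cong: if_cong)

lemma unit_mat_idempotent:
  assumes "p < n"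
  shows "unit_mat n p p * unit_mat n p p = (unit_mat n p p :: 'a::semiring_1 mat)"
proof (rule eq_matI)
  fix i j assume "i < dim_row (unit_mat n p p :: 'a mat)" "j < dim_col (unit_mat n p p :: 'a mat)"
  then have ij: "i < n" "j < n" by (simp_all add: unit_mat_def)
  show "(unit_mat n p p * unit_mat n p p) $$ (i, j) = (unit_mat n p p :: 'a mat) $$ (i, j)"
    unfolding unit_mat_mult_left[OF unit_mat_carrier ij assms]
    using ij assms by (simp add: unit_mat_def)
qed (simp_all add: unit_mat_def)

context complex_algebra
begin

text \<open>If x is in the radical of the form and has a nonzero entry x_pq in some block, then E_pp
  x E_qp = x_pq E_pp. The left side has trace 0 by cyclicity, the right side does not, E_pp being a
  nonzero idempotent.\<close>

lemma matrix_algebra_metric_invertible: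
  assumes iso: "matrix_algebra_iso mult r n \<Phi>"
  shows "invertible (algebra_metric mult)"
proof (rule metric_invertibleI, rule ccontr)
  fix x assume tr0: "\<And>y. tr (y \<star> x) = 0" and "x \<noteq> 0"
  have bij: "bij_betw \<Phi> UNIV (\<Pi>\<^sub>E b\<in>{..<r}. carrier_mat (n b) (n b))"
    and scale: "\<And>b c x. b < r \<Longrightarrow> \<Phi> (c *s x) b = c \<cdot>\<^sub>m \<Phi> x b"
    and mult: "\<And>b x y. b < r \<Longrightarrow> \<Phi> (x \<star> y) b = \<Phi> x b * \<Phi> y b"
    using iso by (auto simp: matrix_algebra_iso_def)
  have range: "\<Phi> x \<in> (\<Pi>\<^sub>E b\<in>{..<r}. carrier_mat (n b) (n b))" for x
    using bij by (auto simp: bij_betw_def)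
  have carrier: "\<Phi> x b \<in> carrier_mat (n b) (n b)" if "b < r" for x b
    using range[of x] that by (auto simp: PiE_def Pi_def)
  have eqI: "v = w" if "\<And>b. b < r \<Longrightarrow> \<Phi> v b = \<Phi> w b" for v w
  proof -
    have "\<Phi> v = \<Phi> w" using that by (intro PiE_ext[OF range range]) simp
    then show ?thesis using bij by (auto simp: bij_betw_def inj_on_def)
  qed
  have zero: "\<Phi> 0 b = 0\<^sub>m (n b) (n b)" if "b < r" for b
  proof -
    have "\<Phi> 0 b = 0 \<cdot>\<^sub>m \<Phi> 0 b" using scale[OF that, of 0 0] by simp
    also have "\<dots> = 0\<^sub>m (n b) (n b)" using carrier[OF that, of 0] by (intro eq_matI) auto
    finally show ?thesis .
  qed
  obtain b where b: "b < r" "\<Phi> x b \<noteq> 0\<^sub>m (n b) (n b)"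
    using eqI[of x 0] \<open>x \<noteq> 0\<close> zero by auto
  then obtain p q where pq: "p < n b" "q < n b" "\<Phi> x b $$ (p, q) \<noteq> 0"
    using carrier[OF b(1), of x] by (metis carrier_matD eq_matI index_zero_mat)
  \<comment> \<open>Surjectivity of \<open>\<Phi>\<close> pulls back the matrix units of block
    \<open>b\<close>, extended by 0 to the other blocks.\<close>
  have "\<exists>v. \<forall>c<r. \<Phi> v c = (if c = b then unit_mat (n b) i j else 0\<^sub>m (n c) (n c))" for i j
  proof -
    let ?M = "\<lambda>c\<in>{..<r}. if c = b then unit_mat (n b) i j else 0\<^sub>m (n c) (n c)"
    have "?M \<in> (\<Pi>\<^sub>E b\<in>{..<r}. carrier_mat (n b) (n b))" by auto
    then have "?M \<in> range \<Phi>" using bij unfolding bij_betw_def by simp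
    then obtain v where "\<Phi> v = ?M" by fastforce
    then show ?thesis by (intro exI[of _ v]) simp
  qed
  then obtain E where E: "\<And>i j c. c < r \<Longrightarrow>
      \<Phi> (E i j) c = (if c = b then unit_mat (n b) i j else 0\<^sub>m (n c) (n c))"
    by metis
  have zmult: "0\<^sub>m k k * M = 0\<^sub>m k k" "c \<cdot>\<^sub>m 0\<^sub>m k k = 0\<^sub>m k k"
    if "M \<in> carrier_mat k k" for k and M :: "complex mat" and c :: complex
    using that by auto
  have corner: "E p p \<star> v \<star> E q p = \<Phi> v b $$ (p, q) *s E p p" if "q < n b" for v q
  proof (rule eqI)
    fix c assume c: "c < r"
    show "\<Phi> (E p p \<star> v \<star> E q p) c = \<Phi> (\<Phi> v b $$ (p, q) *s E p p) c"
    proof (cases "c = b")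
      case True
      have "unit_mat (n b) p p * \<Phi> v b * unit_mat (n b) q p =
          \<Phi> v b $$ (p, q) \<cdot>\<^sub>m unit_mat (n b) p p"
      proof (rule eq_matI)
        fix i j assume "i < dim_row (\<Phi> v b $$ (p, q) \<cdot>\<^sub>m unit_mat (n b) p p)"
          "j < dim_col (\<Phi> v b $$ (p, q) \<cdot>\<^sub>m unit_mat (n b) p p)"
        then have ij: "i < n b" "j < n b" by (simp_all add: unit_mat_def)
        have 1: "unit_mat (n b) p p * \<Phi> v b \<in> carrier_mat (n b) (n b)"
          using carrier[OF b(1)] unit_mat_carrier by (rule mult_carrier_mat[rotated])
        show "(unit_mat (n b) p p * \<Phi> v b * unit_mat (n b) q p) $$ (i, j) =
            (\<Phi> v b $$ (p, q) \<cdot>\<^sub>m unit_mat (n b) p p) $$ (i, j)"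
          unfolding unit_mat_mult_right[OF 1 ij that]
            unit_mat_mult_left[OF carrier[OF b(1)] ij(1) that pq(1)]
          using ij by (simp add: unit_mat_def)
      qed (use carrier[OF b(1), of v] in \<open>auto simp: unit_mat_def\<close>)
      then show ?thesis using True b(1) by (simp add: mult scale E)
    next
      case False
      then show ?thesis using c carrier[OF c, of v] by (simp add: mult scale E zmult)
    qed
  qed
  have "E p p \<noteq> 0"
  proof
    assume "E p p = 0"
    then have "\<Phi> (E p p) b $$ (p, p) = 0" using zero[OF b(1)] pq by simp
    then show False using E[OF b(1), of p p] pq(1) by (simp add: unit_mat_def)
  qed
  moreover have "E p p \<star> E p p = E p p"
  proof (rule eqI)
    fix c assume c: "c < r"
    then show "\<Phi> (E p p \<star> E p p) c = \<Phi> (E p p) c"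
      using pq(1) by (auto simp: mult E unit_mat_idempotent)
  qed
  ultimately have "tr (E p p) \<noteq> 0" by (intro tr_idempotent_nonzero)
  moreover have "tr (E p p \<star> x \<star> E q p) = 0"
    using tr0[of "E q p \<star> E p p"] tr_commute[of "E p p \<star> x" "E q p"] by (simp add: assoc)
  ultimately show False using pq(3) corner[OF pq(2), of x] by (simp add: tr.scale)
qed

end

text \<open>The passage from block decompositions to the trace form; the correspondence with field
  theories works with the latter.\<close>

lemma semisimple_algebra_iff_frobenius: "semisimple_algebra m \<longleftrightarrow> frobenius_algebra m"
proof
  assume m: "semisimple_algebra m"
  then interpret complex_algebra m by unfold_locales (auto simp: semisimple_algebra_def)
  show "frobenius_algebra m"
    using m matrix_algebra_metric_invertible by unfold_locales (auto simp: semisimple_algebra_def)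
qed (rule frobenius_algebra.semisimple)

section \<open>The two assignments between field theories and algebras, and why they are mutually
  inverse\<close>

section \<open>Lattice topological field theories\<close>

lemma mult_basis_expansion: "m (\<phi> i) (\<phi> j) = (\<Sum>k\<in>UNIV. struct_const m i j k *s \<phi> k)"
  by (simp add: Finite_Cartesian_Product.vec_eq_iff sum_scaled_basis_nth struct_const_def
      del: sum_component vector_smult_component)

lemma bilinear_expansion:
  assumes "complex_bilinear m"
  shows "m x y = (\<Sum>i\<in>UNIV. \<Sum>j\<in>UNIV. (x $ i * y $ j) *s m (\<phi> i) (\<phi> j))"
proof -
  interpret left: Vector_Spaces.linear "(*s)" "(*s)" "\<lambda>v. m v w" for w
    using assms by (simp add: complex_bilinear_def)
  interpret right: Vector_Spaces.linear "(*s)" "(*s)" "\<lambda>w. m v w" for v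
    using assms by (simp add: complex_bilinear_def)
  have "m (\<phi> i) y = (\<Sum>j\<in>UNIV. y $ j *s m (\<phi> i) (\<phi> j))" for i
    by (subst basis_vec_expansion[of y, symmetric]) (simp only: right.sum right.scale)
  moreover have "m x y = (\<Sum>i\<in>UNIV. x $ i *s m (\<phi> i) y)"
    by (subst basis_vec_expansion[of x, symmetric]) (simp only: left.sum left.scale)
  ultimately show ?thesis by (simp add: vec.scale_sum_right)
qed

lemma bilinear_assocI:
  assumes "complex_bilinear m"
    and basis: "\<And>i j k. m (m (\<phi> i) (\<phi> j)) (\<phi> k) = m (\<phi> i) (m (\<phi> j) (\<phi> k))"
  shows "m (m x y) z = m x (m y z)"
proof -
  interpret left: Vector_Spaces.linear "(*s)" "(*s)" "\<lambda>v. m v w" for w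
    using assms by (simp add: complex_bilinear_def)
  interpret right: Vector_Spaces.linear "(*s)" "(*s)" "\<lambda>w. m v w" for v
    using assms by (simp add: complex_bilinear_def)
  note expand = basis_vec_expansion[symmetric]
  have 1: "m (m (\<phi> i) (\<phi> j)) z = m (\<phi> i) (m (\<phi> j) z)" for i j
    by (subst (1 2) expand[of z]) (simp only: right.sum right.scale basis)
  have 2: "m (m (\<phi> i) y) z = m (\<phi> i) (m y z)" for i
    by (subst (1 2) expand[of y]) (simp only: left.sum left.scale right.sum right.scale 1)
  show ?thesis
    by (subst (1 2) expand[of x]) (simp only: left.sum left.scale 2)
qed

lemma matrix_inv_eqI:
  assumes "A ** B = Finite_Cartesian_Product.mat 1" "B ** A = Finite_Cartesian_Product.mat 1"
  shows "matrix_inv A = B"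
proof -
  have "invertible A" using assms by (auto simp: invertible_def)
  then have "matrix_inv A ** (A ** B) = B"
    by (simp add: matrix_mul_assoc matrix_inv_left)
  then show ?thesis using assms by simp
qed

lemma matrix_inv_symmetric:
  fixes A :: "'a::comm_semiring_1 ^ 'n ^ 'n"
  assumes "invertible A" "\<And>i j. A $ i $ j = A $ j $ i"
  shows "matrix_inv A $ i $ j = matrix_inv A $ j $ i"
proof -
  let ?B = "Finite_Cartesian_Product.transpose (matrix_inv A)"
  have A: "Finite_Cartesian_Product.transpose A = A"
    using assms(2) by (simp add: Finite_Cartesian_Product.transpose_def Finite_Cartesian_Product.vec_eq_iff)
  have "matrix_inv A = ?B"
  proof (rule matrix_inv_eqI)
    show "A ** ?B = Finite_Cartesian_Product.mat 1"
      using matrix_transpose_mul[of "matrix_inv A" A]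
      by (simp add: A matrix_inv_left[OF assms(1)] transpose_mat)
    show "?B ** A = Finite_Cartesian_Product.mat 1"
      using matrix_transpose_mul[of A "matrix_inv A"]
      by (simp add: A matrix_inv_right[OF assms(1)] transpose_mat)
  qed
  then have "matrix_inv A $ i $ j = ?B $ i $ j" by simp
  then show ?thesis by (simp add: Finite_Cartesian_Product.transpose_def)
qed

text \<open>Raising and lowering an index cancel; \<open>A\<close> may be the metric or its inverse,
  which covers both orders.\<close>

lemma sum_matrix_mult_cancel:
  assumes "A ** B = Finite_Cartesian_Product.mat 1"
  shows "(\<Sum>l\<in>UNIV. (\<Sum>q\<in>UNIV. c q * A $ q $ l) * B $ l $ k) = (c k :: 'a::comm_semiring_1)"
proof -
  have "(\<Sum>l\<in>UNIV. (\<Sum>q\<in>UNIV. c q * A $ q $ l) * B $ l $ k) = (\<Sum>q\<in>UNIV. c q * (A ** B) $ q $ k)"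
    unfolding sum_distrib_right matrix_matrix_mult_def
    by (subst sum.swap) (simp add: sum_distrib_left mult.assoc)
  also have "\<dots> = c k"
    by (simp add: assms Finite_Cartesian_Product.mat_def if_distrib[of "(*) _"] cong: if_cong)
  finally show ?thesis .
qed

lemma ltft_algebra_bilinear: "complex_bilinear (ltft_algebra T)"
  unfolding complex_bilinear_def ltft_algebra_def split_beta
  by (intro conjI allI; unfold_locales)
    (simp_all add: algebra_simps vec.scale_left_distrib sum.distrib vec.scale_sum_right)

text \<open>This is the bubble move, the structure constants of the algebra being
  \<open>raise_last C g\<close>.\<close>

lemma algebra_metric_ltft_algebra:
  assumes "is_ltft C g"
  shows "algebra_metric (ltft_algebra (C, g)) = matrix_inv g"
  using assms
  by (simp add: algebra_metric_def struct_const_ltft_algebra is_ltft_def Finite_Cartesian_Product.vec_eq_iff)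

lemma matrix_inv_inv: "invertible A \<Longrightarrow> matrix_inv (matrix_inv A) = A"
  by (intro matrix_inv_eqI matrix_inv_left matrix_inv_right)

lemma ltft_algebra_frobenius:
  assumes "is_ltft C g"
  shows "frobenius_algebra (ltft_algebra (C, g))"
proof
  let ?m = "ltft_algebra (C, g)"
  have g: "invertible g" using assms by (simp add: is_ltft_def)
  show "complex_bilinear ?m" by (rule ltft_algebra_bilinear)
  then interpret left: Vector_Spaces.linear "(*s)" "(*s)" "\<lambda>v. ?m v w" for w
    by (simp add: complex_bilinear_def)
  interpret right: Vector_Spaces.linear "(*s)" "(*s)" "\<lambda>w. ?m v w" for v
    using ltft_algebra_bilinear[of "(C, g)"] by (simp add: complex_bilinear_def)
  have "?m (?m (\<phi> i) (\<phi> j)) (\<phi> k) = ?m (\<phi> i) (?m (\<phi> j) (\<phi> k))" for i j k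
  proof -
    have "?m (?m (\<phi> i) (\<phi> j)) (\<phi> k) $ l = ?m (\<phi> i) (?m (\<phi> j) (\<phi> k)) $ l" for l
    proof -
      have "?m (?m (\<phi> i) (\<phi> j)) (\<phi> k) $ l =
          (\<Sum>p\<in>UNIV. raise_last C g i j p * struct_const ?m p k l)"
        by (simp add: ltft_algebra_basis[of _ _ i j] left.sum left.scale struct_const_def)
      \<comment> \<open>The fusion move, read as an identity of coefficients.\<close>
      also have "\<dots> = (\<Sum>p\<in>UNIV. raise_last C g j k p * struct_const ?m i p l)"
        using assms by (simp add: struct_const_ltft_algebra is_ltft_def)
      also have "\<dots> = ?m (\<phi> i) (?m (\<phi> j) (\<phi> k)) $ l"
        by (simp add: ltft_algebra_basis[of _ _ j k] right.sum right.scale struct_const_def)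
      finally show ?thesis .
    qed
    then show ?thesis by (simp add: Finite_Cartesian_Product.vec_eq_iff)
  qed
  then show "?m (?m x y) z = ?m x (?m y z)" for x y z
    by (rule bilinear_assocI[OF ltft_algebra_bilinear])
  show "invertible (algebra_metric ?m)"
    unfolding algebra_metric_ltft_algebra[OF assms] invertible_def
    using matrix_inv_left[OF g] matrix_inv_right[OF g] by blast
qed

lemma algebra_ltft_ltft_algebra:
  assumes "is_ltft C g"
  shows "algebra_ltft (ltft_algebra (C, g)) = (C, g)"
proof -
  have g: "invertible g" using assms by (simp add: is_ltft_def)
  have "(\<Sum>l\<in>UNIV. raise_last C g i j l * matrix_inv g $ l $ k) = C i j k" for i j k
    unfolding raise_last_def by (rule sum_matrix_mult_cancel[OF matrix_inv_right[OF g]])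
  then show ?thesis
    by (simp add: algebra_ltft_def algebra_metric_ltft_algebra[OF assms] struct_const_ltft_algebra
        matrix_inv_inv[OF g])
qed

context frobenius_algebra
begin

text \<open>Identifies C_ijk with the trace of a triple product, from which its cyclic symmetry
  follows.\<close>

lemma lowered_struct_const:
  "(\<Sum>l\<in>UNIV. struct_const mult i j l * algebra_metric mult $ l $ k) = tr (\<phi> i \<star> \<phi> j \<star> \<phi> k)"
  by (subst mult_basis_expansion[of _ i j])
    (simp only: left.sum left.scale tr.sum tr.scale tr_basis)

lemma raise_last_algebra_ltft:
  "raise_last (fst (algebra_ltft mult)) (snd (algebra_ltft mult)) = struct_const mult"
  unfolding raise_last_def algebra_ltft_def fst_conv snd_conv
  by (intro ext sum_matrix_mult_cancel matrix_inv_right metric_invertible)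

text \<open>Raising the lowered structure constants returns the original ones, and a bilinear
  product is determined by them.\<close>

lemma ltft_algebra_algebra_ltft: "ltft_algebra (algebra_ltft mult) = mult"
proof (intro ext)
  fix x y
  let ?m = "ltft_algebra (algebra_ltft mult)"
  have "?m (\<phi> i) (\<phi> j) = \<phi> i \<star> \<phi> j" for i j
    using ltft_algebra_basis[of "fst (algebra_ltft mult)" "snd (algebra_ltft mult)" i j]
    by (simp add: raise_last_algebra_ltft mult_basis_expansion[of mult])
  then show "?m x y = x \<star> y"
    by (simp add: bilinear_expansion[OF ltft_algebra_bilinear, of _ x y]
        bilinear_expansion[OF bilinear, of x y])
qed

lemma is_ltft_algebra_ltft: "is_ltft (fst (algebra_ltft mult)) (snd (algebra_ltft mult))"
  unfolding is_ltft_def raise_last_algebra_ltft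
proof (intro conjI allI)
  fix i j k l
  have cyclic: "tr (\<phi> i \<star> \<phi> j \<star> \<phi> k) = tr (\<phi> j \<star> \<phi> k \<star> \<phi> i)" for i j k
    using tr_commute[of "\<phi> i" "\<phi> j \<star> \<phi> k"] by (simp add: assoc)
  show "fst (algebra_ltft mult) i j k = fst (algebra_ltft mult) j k i"
    "fst (algebra_ltft mult) j k i = fst (algebra_ltft mult) k i j"
    unfolding algebra_ltft_def fst_conv lowered_struct_const by (rule cyclic)+
  show "snd (algebra_ltft mult) $ i $ j = snd (algebra_ltft mult) $ j $ i"
    unfolding algebra_ltft_def snd_conv
    by (intro matrix_inv_symmetric metric_invertible metric_symmetric)
  show "invertible (snd (algebra_ltft mult))"
    unfolding algebra_ltft_def snd_conv invertible_def
    using matrix_inv_left[OF metric_invertible] matrix_inv_right[OF metric_invertible] by blast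
  have "(\<Sum>p\<in>UNIV. struct_const mult i j p * struct_const mult p k l) = (\<phi> i \<star> \<phi> j \<star> \<phi> k) $ l"
    by (subst mult_basis_expansion[of _ i j])
      (simp add: left.sum left.scale struct_const_def)
  also have "\<dots> = (\<phi> i \<star> (\<phi> j \<star> \<phi> k)) $ l" by (simp add: assoc)
  also have "\<dots> = (\<Sum>p\<in>UNIV. struct_const mult j k p * struct_const mult i p l)"
    by (subst mult_basis_expansion[of _ j k])
      (simp add: right.sum right.scale struct_const_def)
  finally show "(\<Sum>p\<in>UNIV. struct_const mult i j p * struct_const mult p k l) =
      (\<Sum>p\<in>UNIV. struct_const mult j k p * struct_const mult i p l)" .
  \<comment> \<open>The inverse of the inverse is the metric, so the bubble move is its defining
    formula.\<close>
  show "matrix_inv (snd (algebra_ltft mult)) $ i $ j =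
      (\<Sum>k\<in>UNIV. \<Sum>l\<in>UNIV. struct_const mult i k l * struct_const mult j l k)"
    unfolding algebra_ltft_def snd_conv matrix_inv_inv[OF metric_invertible]
    by (simp add: algebra_metric_def)
qed

end

theorem theorem3:
  fixes A :: nat
  assumes "CARD('n::finite) = A + 1"
  shows "bij_betw ltft_algebra (ltfts :: ('n tensor3 \<times> (complex ^ 'n ^ 'n)) set) semisimple_algebras \<and>
    (\<forall>m \<in> (semisimple_algebras :: 'n product set).
       invertible (algebra_metric m) \<and>
       algebra_ltft m \<in> ltfts \<and>
       ltft_algebra (algebra_ltft m) = m) \<and>
    (\<forall>T \<in> (ltfts :: ('n tensor3 \<times> (complex ^ 'n ^ 'n)) set).
       algebra_ltft (ltft_algebra T) = T)"
proof (intro conjI ballI)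
  have frobenius: "frobenius_algebra m" if "m \<in> semisimple_algebras" for m :: "'n product"
    using that by (simp add: semisimple_algebras_def semisimple_algebra_iff_frobenius)
  show "invertible (algebra_metric m)" if "m \<in> semisimple_algebras" for m :: "'n product"
    using frobenius[OF that] by (rule frobenius_algebra.metric_invertible)
  show ltft: "algebra_ltft m \<in> ltfts" if "m \<in> semisimple_algebras" for m :: "'n product"
    using frobenius_algebra.is_ltft_algebra_ltft[OF frobenius[OF that]]
    by (simp add: ltfts_def split_beta)
  show right_inverse: "ltft_algebra (algebra_ltft m) = m"
    if "m \<in> semisimple_algebras" for m :: "'n product"
    using frobenius[OF that] by (rule frobenius_algebra.ltft_algebra_algebra_ltft)
  show left_inverse: "algebra_ltft (ltft_algebra T) = T"
    if "T \<in> ltfts" for T :: "'n tensor3 \<times> (complex ^ 'n ^ 'n)"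
    using that algebra_ltft_ltft_algebra by (auto simp: ltfts_def)
  have "ltft_algebra T \<in> semisimple_algebras"
    if "T \<in> ltfts" for T :: "'n tensor3 \<times> (complex ^ 'n ^ 'n)"
    using that ltft_algebra_frobenius
    by (auto simp: ltfts_def semisimple_algebras_def semisimple_algebra_iff_frobenius)
  then show "bij_betw ltft_algebra (ltfts :: ('n tensor3 \<times> (complex ^ 'n ^ 'n)) set) semisimple_algebras"
    using left_inverse right_inverse ltft
    by (intro bij_betw_byWitness[where f' = algebra_ltft]) auto
qed

end
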